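(* Let $T$ be an infinite rooted tree such that the sequence $\{c_n\}$ is unbounded and let $p,q\in(0,\infty]$ with $p\neq q$. Then there is no isometric multiplication operator $M_\psi$ from $\mathbb{T}_p$ to $\mathbb{T}_q$; that is, there is no function $\psi:T\to\mathbb{C}$ such that $\psi f\in\mathbb{T}_q$ and $\|\psi f\|_q=\|f\|_p$ for all $f\in\mathbb{T}_p$.
   Context: Let $T$ be an infinite rooted tree with root $o$; $T$ also denotes its vertex set. For a vertex $v$, $|v|$ is the number of edges in the unique path from $o$ to $v$. For $n\in\mathbb{N}_0=\{0,1,2,\dots\}$, $D_n=\{v\in T:|v|=n\}$, and $c_n$ is the number of elements of $D_n$, assumed finite for each $n$ (so $1\le c_n<\infty$). For $f:T\to\mathbb{C}$ and $0<p<\infty$ put $M_p(n,f)=\left(\frac1{c_n}\sum_{|v|=n}|f(v)|^p\right)^{1/p}$, and $M_\infty(n,f)=\max_{|v|=n}|f(v)|$. For $0<p\le\infty$ put $\|f\|_p=\sup_{n\in\mathbb{N}_0}M_p(n,f)$ and $\mathbb{T}_p=\{f:T\to\mathbb{C}:\|f\|_p<\infty\}$. For $\psi:T\to\mathbb{C}$, the multiplication operator is $M_\psi f=\psi f$ (pointwise product). *)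

theory Defs
  imports
    Complex_Main
    "HOL-Library.Extended_Nonnegative_Real"
    "Graph_Theory.Digraph_Component"
begin

text \<open>
  An undirected simple graph is a symmetric loop-free digraph without parallel arcs.
  The predicate \<^const>\<open>tree\<close> of the graph library is not used: it forbids directed cycles,
  and in a symmetric digraph every edge a, b yields the directed cycle a, b, a.
  In a symmetric simple digraph the cycles of the undirected graph are
  the directed cycles of length at least 3.
\<close>

locale rooted_tree = pair_bidirected_digraph T
  for T :: "'a pair_pre_digraph" and r :: 'a +
  assumes root_in_verts: "r \<in> pverts T"
    and connected: "Digraph_Component.connected (with_proj T)"
    and acyclic: "\<not> (\<exists>p. pre_digraph.cycle (with_proj T) p \<and> 3 \<le> length p)"

definition depth :: "'a pair_pre_digraph \<Rightarrow> 'a \<Rightarrow> 'a \<Rightarrow> nat" where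
  "depth T r v = length (THE p. pre_digraph.apath (with_proj T) r p v)"

definition level :: "'a pair_pre_digraph \<Rightarrow> 'a \<Rightarrow> nat \<Rightarrow> 'a set" where
  "level T r n = {v \<in> pverts T. depth T r v = n}"

definition level_size :: "'a pair_pre_digraph \<Rightarrow> 'a \<Rightarrow> nat \<Rightarrow> nat" where
  "level_size T r n = card (level T r n)"

text \<open>
  A function on the vertices is a function on the whole type whose values
  outside the vertex set are irrelevant.
\<close>

definition level_mean ::
    "'a pair_pre_digraph \<Rightarrow> 'a \<Rightarrow> ennreal \<Rightarrow> nat \<Rightarrow> ('a \<Rightarrow> complex) \<Rightarrow> real" where
  "level_mean T r p n f =
     (if p = \<infinity> then Max ((\<lambda>v. cmod (f v)) ` level T r n)
      else ((1 / real (level_size T r n)) * (\<Sum>v\<in>level T r n. cmod (f v) powr enn2real p))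
             powr (1 / enn2real p))"

text \<open>The supremum is taken in the extended nonnegative reals, so that it always exists.\<close>

definition Tp_norm ::
    "'a pair_pre_digraph \<Rightarrow> 'a \<Rightarrow> ennreal \<Rightarrow> ('a \<Rightarrow> complex) \<Rightarrow> ennreal" where
  "Tp_norm T r p f = (SUP n. ennreal (level_mean T r p n f))"

definition Tp_space ::
    "'a pair_pre_digraph \<Rightarrow> 'a \<Rightarrow> ennreal \<Rightarrow> ('a \<Rightarrow> complex) set" where
  "Tp_space T r p = {f. Tp_norm T r p f < \<infinity>}"

definition mult_op :: "('a \<Rightarrow> complex) \<Rightarrow> ('a \<Rightarrow> complex) \<Rightarrow> 'a \<Rightarrow> complex" where
  "mult_op \<psi> f = (\<lambda>v. \<psi> v * f v)"

definition isometric_mult_op ::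
    "'a pair_pre_digraph \<Rightarrow> 'a \<Rightarrow> ennreal \<Rightarrow> ennreal \<Rightarrow> ('a \<Rightarrow> complex) \<Rightarrow> bool" where
  "isometric_mult_op T r p q \<psi> \<longleftrightarrow>
     (\<forall>f \<in> Tp_space T r p.
        mult_op \<psi> f \<in> Tp_space T r q \<and> Tp_norm T r q (mult_op \<psi> f) = Tp_norm T r p f)"

end

theory Submission
  imports Defs
begin

text \<open>
  Testing the isometry on the indicator function of a vertex v of level n gives
  the value c powr (1/q - 1/p) for the modulus of the multiplier at v, where c is the
  size of the level. Testing it on the indicator function of the whole level
  then yields c powr (1/q - 1/p) = 1, so p = q as soon as c > 1.

  An empty level would contribute the unspecified
  value Max {} to the norm with exponent infinity, and this value is outweighed by
  scaling the test function. Since 1 / enn2real p = 0 for infinite p, the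
  expression 1 / enn2real p needs no case distinction.
\<close>

lemma level_mean_nonneg:
  assumes "finite (level T r n)" "level T r n \<noteq> {}"
  shows "0 \<le> level_mean T r p n f"
proof -
  obtain v where "v \<in> level T r n"
    using assms(2) by blast
  then have "cmod (f v) \<le> Max ((\<lambda>v. cmod (f v)) ` level T r n)"
    using assms(1) by (intro Max_ge) auto
  then show ?thesis
    unfolding level_mean_def using order_trans[OF norm_ge_zero] by auto
qed

lemma enn2real_pos: "0 < p \<Longrightarrow> p \<noteq> \<infinity> \<Longrightarrow> 0 < enn2real p"
  by (simp add: enn2real_positive_iff top.not_eq_extremum)

lemma level_mean_scale:
  assumes "finite (level T r n)" "level T r n \<noteq> {}" "0 < p" "0 \<le> a"
  shows "level_mean T r p n (\<lambda>v. complex_of_real a * f v) = a * level_mean T r p n f"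
proof (cases "p = \<infinity>")
  case True
  \<comment> \<open>Multiplication by a nonnegative \<open>a\<close> is monotone and so commutes
    with the maximum of a finite nonempty set.\<close>
  have "a * Max ((\<lambda>v. cmod (f v)) ` level T r n) =
      Max ((*) a ` (\<lambda>v. cmod (f v)) ` level T r n)"
    using assms by (intro mono_Max_commute) (auto simp: mono_def intro: mult_left_mono)
  then show ?thesis
    using True assms(4) by (simp add: level_mean_def norm_mult image_image)
next
  case False
  define s where "s = enn2real p"
  have s: "0 < s"
    using enn2real_pos[OF assms(3) False] by (simp add: s_def)
  have "(1 / real (level_size T r n)) *
        (\<Sum>v\<in>level T r n. cmod (complex_of_real a * f v) powr s) =
      a powr s * ((1 / real (level_size T r n)) * (\<Sum>v\<in>level T r n. cmod (f v) powr s))"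
    using assms(4) by (simp add: norm_mult powr_mult sum_distrib_left)
  also have "\<dots> powr (1 / s) =
      a * ((1 / real (level_size T r n)) * (\<Sum>v\<in>level T r n. cmod (f v) powr s)) powr (1 / s)"
    using s assms(4) by (subst powr_mult) (auto simp: powr_powr sum_nonneg)
  finally show ?thesis
    using False by (simp add: level_mean_def s_def)
qed

lemma level_mean_const:
  assumes "finite (level T r n)" "level T r n \<noteq> {}" "0 < p"
    and "\<And>v. v \<in> level T r n \<Longrightarrow> cmod (f v) = a"
  shows "level_mean T r p n f = a"
proof (cases "p = \<infinity>")
  case True
  have "(\<lambda>v. cmod (f v)) ` level T r n = {a}"
    using assms(2,4) by auto
  then show ?thesis
    using True by (simp add: level_mean_def)
next
  case False
  \<comment> \<open>As the modulus of some value, \<open>a\<close> is nonnegative, so that raising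
    to the exponent and taking the root cancel.\<close>
  have "0 \<le> a"
    using assms(2,4) norm_ge_zero by fastforce
  then show ?thesis
    using False assms enn2real_pos[OF assms(3) False]
    by (simp add: level_mean_def level_size_def powr_powr)
qed

text \<open>The one surviving term is divided by the level size before the root is taken, whence the
  factor. For \<open>p = \<infinity>\<close> the exponent is 0 and the factor becomes 1.\<close>

lemma level_mean_single:
  assumes "finite (level T r n)" "v \<in> level T r n" "0 < p"
    and "\<And>u. u \<in> level T r n \<Longrightarrow> u \<noteq> v \<Longrightarrow> f u = 0"
  shows "level_mean T r p n f =
    cmod (f v) * real (level_size T r n) powr (- (1 / enn2real p))"
proof -
  have c: "0 < real (level_size T r n)"
    using assms(1,2) by (auto simp: level_size_def card_gt_0_iff)
  show ?thesis
  proof (cases "p = \<infinity>")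
    case True
    have "Max ((\<lambda>v. cmod (f v)) ` level T r n) = cmod (f v)"
    proof (rule Max_eqI)
      fix y assume "y \<in> (\<lambda>v. cmod (f v)) ` level T r n"
      then show "y \<le> cmod (f v)"
        using assms(4) by force
    next
      show "cmod (f v) \<in> (\<lambda>v. cmod (f v)) ` level T r n"
        using assms(2) by (rule imageI)
    qed (use assms(1) in simp)
    then show ?thesis
      using True c by (simp add: level_mean_def)
  next
    case False
    define s where "s = enn2real p"
    have s: "0 < s"
      using enn2real_pos[OF assms(3) False] by (simp add: s_def)
    have "(\<Sum>u\<in>level T r n. cmod (f u) powr s) =
        (\<Sum>u\<in>{v}. cmod (f u) powr s)"
      using assms by (intro sum.mono_neutral_right) auto
    then have "level_mean T r p n f =
        (cmod (f v) powr s * inverse (real (level_size T r n))) powr (1 / s)"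
      using False by (simp add: level_mean_def s_def field_simps)
    also have "\<dots> = cmod (f v) * inverse (real (level_size T r n)) powr (1 / s)"
      using s c by (subst powr_mult) (auto simp: powr_powr)
    also have "inverse (real (level_size T r n)) powr (1 / s) =
        real (level_size T r n) powr (- (1 / s))"
      using c by (simp add: powr_minus inverse_powr)
    finally show ?thesis
      by (simp add: s_def)
  qed
qed

lemma Tp_norm_ge: "ennreal (level_mean T r p n f) \<le> Tp_norm T r p f"
  unfolding Tp_norm_def by (rule SUP_upper) simp

text \<open>Every other level contributes 0, except that an empty one contributes
  \<open>Max {}\<close> when \<open>p = \<infinity>\<close>. The bound absorbs both, as
  \<open>ennreal\<close> sends negative reals to 0.\<close>

lemma Tp_norm_le:
  assumes "\<And>m. finite (level T r m)" "\<And>v. v \<notin> level T r n \<Longrightarrow> f v = 0"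
  shows "Tp_norm T r p f \<le> ennreal (max (level_mean T r p n f) (Max {}))"
  unfolding Tp_norm_def
proof (rule SUP_least)
  fix m
  show "ennreal (level_mean T r p m f) \<le> ennreal (max (level_mean T r p n f) (Max {}))"
  proof (cases "m = n")
    case False
    then have zero: "f v = 0" if "v \<in> level T r m" for v
      using that assms(2) by (auto simp: level_def)
    show ?thesis
    proof (cases "p = \<infinity> \<and> level T r m = {}")
      case True
      then show ?thesis
        by (intro ennreal_leI) (simp add: level_mean_def)
    next
      case nonempty: False
      \<comment> \<open>An empty level with finite \<open>p\<close> has mean 0 as well, because its
        sum is empty.\<close>
      have "(\<lambda>v. cmod (f v)) ` level T r m = {0}" if "level T r m \<noteq> {}"
        using zero that by auto
      then have "level_mean T r p m f = 0"
        using nonempty zero by (auto simp: level_mean_def)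
      then show ?thesis by simp
    qed
  qed (auto intro: ennreal_leI)
qed

text \<open>For a function supported on one level, the norm is the mean on that level once this mean
  exceeds \<open>Max {}\<close>. Scaling achieves that, and homogeneity removes the scalar
  again.\<close>

lemma isometric_level_mean:
  assumes fin: "\<And>m. finite (level T r m)" and ne: "level T r n \<noteq> {}"
    and "0 < p" "0 < q" and iso: "isometric_mult_op T r p q \<psi>"
    and supp: "\<And>v. v \<notin> level T r n \<Longrightarrow> f v = 0"
    and pos: "0 < level_mean T r p n f"
  shows "level_mean T r q n (mult_op \<psi> f) = level_mean T r p n f"
proof -
  define L where "L = level_mean T r p n f"
  \<comment> \<open>This makes \<open>a * L = \<bar>Max {}\<bar> + 1\<close>, which is above both 0
    and \<open>Max {}\<close>.\<close>
  define a where "a = (\<bar>Max {}\<bar> + 1) / L"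
  have a: "0 < a" and aL: "max 0 (Max {}) < a * L"
    using pos by (auto simp: a_def L_def)
  define g where "g = (\<lambda>v. complex_of_real a * f v)"
  have Mg: "level_mean T r p n g = a * L"
    unfolding g_def L_def using fin ne \<open>0 < p\<close> a by (intro level_mean_scale) auto
  have "mult_op \<psi> g = (\<lambda>v. complex_of_real a * mult_op \<psi> f v)"
    by (auto simp: g_def mult_op_def)
  then have Mh: "level_mean T r q n (mult_op \<psi> g) = a * level_mean T r q n (mult_op \<psi> f)"
    using level_mean_scale[OF fin ne \<open>0 < q\<close>, of a "mult_op \<psi> f"] a by simp
  have "Tp_norm T r p g \<le> ennreal (a * L)"
    using Tp_norm_le[OF fin, of n g p] supp aL unfolding Mg by (simp add: g_def max_absorb1)
  then have Ng: "Tp_norm T r p g = ennreal (a * L)"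
    using Tp_norm_ge[of T r p n g] unfolding Mg by (intro antisym)
  then have "g \<in> Tp_space T r p"
    by (simp add: Tp_space_def)
  then have Nh: "Tp_norm T r q (mult_op \<psi> g) = ennreal (a * L)"
    using iso Ng by (simp add: isometric_mult_op_def)
  have "level_mean T r q n (mult_op \<psi> g) \<le> a * L"
    using Tp_norm_ge[of T r q n "mult_op \<psi> g"] aL unfolding Nh
    by (subst (asm) ennreal_le_iff) auto
  \<comment> \<open>Conversely, the norm of the image is at most the larger of its mean and
    \<open>Max {}\<close>; as \<open>a * L\<close> exceeds \<open>Max {}\<close>, the mean itself
    must reach \<open>a * L\<close>.\<close>
  moreover have "ennreal (a * L) \<le> ennreal (max (level_mean T r q n (mult_op \<psi> g)) (Max {}))"
    using Tp_norm_le[OF fin, of n "mult_op \<psi> g" q] supp unfolding Nh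
    by (simp add: g_def mult_op_def)
  then have "a * L \<le> max (level_mean T r q n (mult_op \<psi> g)) (Max {})"
    using level_mean_nonneg[OF fin ne, of q "mult_op \<psi> g"]
    by (subst (asm) ennreal_le_iff) auto
  ultimately have "level_mean T r q n (mult_op \<psi> g) = a * L"
    using aL by auto
  then show ?thesis
    using Mh a by (simp add: L_def)
qed

text \<open>The reciprocal is positive for a finite exponent and 0 for the infinite one, so it
  separates the two cases; among finite exponents it is injective.\<close>

lemma inverse_enn2real_eq_imp_eq:
  assumes "0 < p" "0 < q" "1 / enn2real p = 1 / enn2real q"
  shows "p = q"
proof (cases "p = \<infinity> \<or> q = \<infinity>")
  case True
  then show ?thesis
    using assms enn2real_pos[of p] enn2real_pos[of q] by fastforce
next
  case False
  then show ?thesis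
    using assms(3) by (metis ennreal_enn2real infinity_ennreal_def inverse_eq_divide
        inverse_eq_iff_eq top.not_eq_extremum)
qed

theorem theorem5:
  fixes T :: "'a pair_pre_digraph" and r :: 'a and p q :: ennreal
  assumes "rooted_tree T r"
    and "infinite (pverts T)"
    and "\<forall>n. finite (level T r n)"
    and "\<not> bdd_above (range (level_size T r))"
    and "0 < p" and "0 < q" and "p \<noteq> q"
  shows "\<not> (\<exists>\<psi>. isometric_mult_op T r p q \<psi>)"
proof
  assume "\<exists>\<psi>. isometric_mult_op T r p q \<psi>"
  then obtain \<psi> where iso: "isometric_mult_op T r p q \<psi>" ..
  have fin: "\<And>m. finite (level T r m)"
    using assms(3) by blast
  \<comment> \<open>Unboundedness yields a level with at least two vertices; a base above 1 is what
    turns \<open>c powr (y - x) = 1\<close> into \<open>x = y\<close> at the end.\<close>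
  obtain n where n: "1 < level_size T r n"
    using assms(4) by (auto simp: bdd_above_def not_le)
  then have ne: "level T r n \<noteq> {}"
    by (auto simp: level_size_def)
  define c where "c = real (level_size T r n)"
  have c: "1 < c"
    using n by (simp add: c_def)
  define x where "x = 1 / enn2real p"
  define y where "y = 1 / enn2real q"
  have \<psi>: "cmod (\<psi> v) = c powr (y - x)" if v: "v \<in> level T r n" for v
  proof -
    define f where "f = (\<lambda>u. if u = v then 1 else 0 :: complex)"
    have Mf: "level_mean T r p n f = c powr (- x)"
      using level_mean_single[OF fin v assms(5), of f] by (simp add: f_def c_def x_def)
    have "level_mean T r q n (mult_op \<psi> f) = cmod (\<psi> v) * c powr (- y)"
      using level_mean_single[OF fin v assms(6), of "mult_op \<psi> f"]
      by (simp add: f_def c_def y_def mult_op_def)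
    moreover have "level_mean T r q n (mult_op \<psi> f) = level_mean T r p n f"
      using Mf c v
      by (intro isometric_level_mean[OF fin ne assms(5,6) iso]) (auto simp: f_def)
    ultimately have "cmod (\<psi> v) * c powr (- y) = c powr (- x)"
      using Mf by simp
    then show ?thesis
      using c by (simp add: powr_minus powr_diff field_simps)
  qed
  define f where "f = (\<lambda>u. if u \<in> level T r n then 1 else 0 :: complex)"
  have Mf: "level_mean T r p n f = 1"
    by (rule level_mean_const[OF fin ne assms(5)]) (simp add: f_def)
  have "level_mean T r q n (mult_op \<psi> f) = level_mean T r p n f"
    using Mf by (intro isometric_level_mean[OF fin ne assms(5,6) iso]) (auto simp: f_def)
  \<comment> \<open>The modulus of \<open>\<psi>\<close> is now known to be constant on the level,
    so the mean of the product is that constant whatever the exponent.\<close>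
  moreover have "level_mean T r q n (mult_op \<psi> f) = c powr (y - x)"
    by (rule level_mean_const[OF fin ne assms(6)]) (simp add: f_def mult_op_def \<psi>)
  ultimately have "c powr (y - x) = 1"
    using Mf by simp
  then have "x = y"
    using c by simp
  then show False
    using inverse_enn2real_eq_imp_eq[OF assms(5,6)] assms(7) by (simp add: x_def y_def)
qed

end
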